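(* Every finite simple graph $G$ on $n$ vertices without isolated vertices satisfies \[ f_{\mathrm{o}}(G)\ge \frac{n}{8}. \]
   Context: All graphs are finite and simple. A graph is called odd if every one of its vertices has odd degree in it (the graph with no vertices is vacuously odd). For $X\subseteq V(G)$, $G[X]$ denotes the subgraph of $G$ induced by $X$. For a graph $G$, define $f_{\mathrm{o}}(G):=\max\{|S| : S\subseteq V(G)\text{ and }G[S]\text{ is odd}\}$. An isolated vertex is a vertex of degree $0$. *)

theory Defs
  imports Complex_Main
begin

text \<open>A graph is a pair of a vertex set and a set of edges, each edge being the
  two-element set of its endpoints.\<close>

type_synonym 'a graph = "'a set \<times> 'a set set"

definition vertices :: "'a graph \<Rightarrow> 'a set" where
  "vertices G = fst G"

definition edges :: "'a graph \<Rightarrow> 'a set set" where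
  "edges G = snd G"

definition finite_simple_graph :: "'a graph \<Rightarrow> bool" where
  "finite_simple_graph G \<longleftrightarrow>
     finite (vertices G) \<and> (\<forall>e\<in>edges G. e \<subseteq> vertices G \<and> card e = 2)"

definition induced_subgraph :: "'a graph \<Rightarrow> 'a set \<Rightarrow> 'a graph" where
  "induced_subgraph G X = (X, {e \<in> edges G. e \<subseteq> X})"

definition degree :: "'a graph \<Rightarrow> 'a \<Rightarrow> nat" where
  "degree G v = card {e \<in> edges G. v \<in> e}"

definition isolated_vertex :: "'a graph \<Rightarrow> 'a \<Rightarrow> bool" where
  "isolated_vertex G v \<longleftrightarrow> v \<in> vertices G \<and> degree G v = 0"

definition odd_graph :: "'a graph \<Rightarrow> bool" where
  "odd_graph G \<longleftrightarrow> (\<forall>v\<in>vertices G. odd (degree G v))"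

text \<open>For finite \<open>G\<close> the maximum ranges over a finite set, which is nonempty because
  the empty vertex set induces an odd graph.\<close>

definition f_o :: "'a graph \<Rightarrow> nat" where
  "f_o G = Max {card S | S. S \<subseteq> vertices G \<and> odd_graph (induced_subgraph G S)}"

end

theory Submission imports Defs begin

text \<open>
  The engine is a consequence of Gallai's theorem that the vertex set of every graph splits
  into two parts each inducing a subgraph with all degrees even. Suppose the vertex set is
  cut into \<open>X\<close> and \<open>U\<close> so that every vertex has an odd number of neighbours on the other
  side of the cut. Take an even partition and switch the two classes on \<open>U\<close>. A vertex keeps
  its same-class neighbours on its own side of the cut and exchanges same-class for
  other-class neighbours across it; as there is an odd number of neighbours across, its
  same-class degree changes parity. So \<open>X \<union> U\<close> splits into two odd sets, and the larger
  one has at least half of the vertices (\<open>partition_into_two_odd_sets\<close>).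

  It remains to find such a pair \<open>X\<close>, \<open>U\<close> covering a quarter of the graph. Without isolated
  vertices, a maximal independent set and its complement dominate each other; let \<open>W\<close> be the
  larger of the two, and dominate it by a smallest possible set \<open>D\<close> outside \<open>W\<close>. Minimality
  gives every \<open>d \<in> D\<close> a private neighbour in \<open>W\<close>, adjacent to no other vertex of \<open>D\<close>. For a
  uniformly random \<open>X \<subseteq> D\<close> each vertex of \<open>W\<close> has an odd number of neighbours in \<open>X\<close> with
  probability one half, so some \<open>X\<close> achieves this for a set \<open>W'\<close> of at least half of \<open>W\<close>.
  The private neighbours of the vertices of \<open>X\<close> belong to \<open>W'\<close>, and deleting the private
  neighbour of \<open>x\<close> changes the degree of \<open>x\<close> into \<open>W'\<close> by one and affects no other vertex
  of \<open>X\<close>. So the parities on the side of \<open>X\<close> can be repaired by deleting at most \<open>card X\<close>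
  vertices, a loss that is made up for by \<open>X\<close> itself: \<open>X \<union> U\<close> has at least \<open>card W'\<close>
  elements. The three halvings, from the graph to \<open>W\<close>, to \<open>W'\<close> and to the larger odd set,
  give the factor 8.
\<close>

section \<open>Parities of neighbourhoods\<close>

definition nbrs :: "('a \<Rightarrow> 'a \<Rightarrow> bool) \<Rightarrow> 'a \<Rightarrow> 'a set \<Rightarrow> 'a set" where
  "nbrs E v U = {u \<in> U. E v u}"

lemma finite_nbrs: "finite U \<Longrightarrow> finite (nbrs E v U)"
  by (simp add: nbrs_def)

lemma card_nbrs_Un_disjoint:
  assumes "finite A" "finite B" "A \<inter> B = {}"
  shows "card (nbrs E v (A \<union> B)) = card (nbrs E v A) + card (nbrs E v B)"
proof -
  have "nbrs E v (A \<union> B) = nbrs E v A \<union> nbrs E v B" "nbrs E v A \<inter> nbrs E v B = {}"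
    using assms(3) by (auto simp: nbrs_def)
  thus ?thesis by (simp add: assms card_Un_disjoint finite_nbrs)
qed

lemma even_card_symmetric_difference:
  assumes "finite A" "finite B"
  shows "even (card ((A - B) \<union> (B - A))) \<longleftrightarrow> even (card A + card B)"
proof -
  have "card A = card (A - B) + card (A \<inter> B)" "card B = card (B - A) + card (A \<inter> B)"
    using assms by (metis Int_commute card_Diff_subset_Int card_Int_Diff add.commute)+
  moreover have "card ((A - B) \<union> (B - A)) = card (A - B) + card (B - A)"
    using assms by (intro card_Un_disjoint) auto
  ultimately show ?thesis by presburger
qed

section \<open>Even and odd vertex partitions\<close>

text \<open>
  This is Gallai's theorem. If some vertex \<open>v\<close> has odd degree, delete it and complement the
  graph on its neighbourhood, and take an even partition of what remains. Of the two classes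
  exactly one contains an even number of neighbours of \<open>v\<close>, and \<open>v\<close> is added to that one. For
  \<open>u\<close> adjacent to \<open>v\<close>, undoing the complementation changes the degree of \<open>u\<close> in its class
  \<open>C\<close> by the parity of the number of other neighbours of \<open>v\<close> in \<open>C\<close>; this is odd precisely
  when \<open>v\<close> joins \<open>C\<close>, and then the new edge from \<open>u\<close> to \<open>v\<close> restores evenness.
\<close>

lemma partition_into_two_even_sets:
  assumes "finite V" "symp E" "irreflp E"
  shows "\<exists>P\<subseteq>V. (\<forall>v\<in>P. even (card (nbrs E v P))) \<and>
                (\<forall>v\<in>V - P. even (card (nbrs E v (V - P))))"
  using assms
proof (induction "card V" arbitrary: V E rule: less_induct)
  case less
  show ?case
  proof (cases "\<forall>v\<in>V. even (card (nbrs E v V))")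
    case True
    thus ?thesis by (intro exI[of _ V]) auto
  next
    case False
    then obtain v where v: "v \<in> V" and odd_v: "odd (card (nbrs E v V))" by blast
    define E' where "E' = (\<lambda>u w. E u w \<noteq> (E v u \<and> E v w \<and> u \<noteq> w))"
    have sym: "E a b \<Longrightarrow> E b a" for a b using less.prems(2) by (auto dest: sympD)
    have irr: "\<not> E a a" for a using less.prems(3) by (auto simp: irreflp_def)
    have sym': "symp E'" by (rule sympI) (auto simp: E'_def dest: sym)
    have irr': "irreflp E'" by (rule irreflpI) (simp add: E'_def irr)
    have smaller: "card (V - {v}) < card V" "finite (V - {v})"
      using v less.prems(1) by (simp_all only: card_Diff1_less finite_Diff)
    from less.hyps[OF smaller sym' irr'] obtain P where P: "P \<subseteq> V - {v}"
        and even_P: "\<forall>u\<in>P. even (card (nbrs E' u P))"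
        and even_Q: "\<forall>u\<in>V - {v} - P. even (card (nbrs E' u (V - {v} - P)))"
      by blast
    define Q where "Q = V - {v} - P"
    have fin: "finite P" "finite Q"
      using P less.prems(1) by (auto simp: Q_def intro: finite_subset)
    \<comment> \<open>The neighbourhoods of \<open>u\<close> before and after the complementation differ by the other
      neighbours of \<open>v\<close>.\<close>
    have toggle: "even (card (nbrs E u C)) \<longleftrightarrow> (E v u \<longrightarrow> odd (card (nbrs E v C)))"
      if "finite C" "u \<in> C" "even (card (nbrs E' u C))" for u C
    proof (cases "E v u")
      case True
      have "nbrs E' u C = (nbrs E u C - (nbrs E v C - {u})) \<union> ((nbrs E v C - {u}) - nbrs E u C)"
        using True by (auto simp: nbrs_def E'_def)
      hence "even (card (nbrs E u C) + card (nbrs E v C - {u}))"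
        using even_card_symmetric_difference[of "nbrs E u C" "nbrs E v C - {u}"] that
        by (simp add: finite_nbrs)
      moreover have "card (nbrs E v C) = Suc (card (nbrs E v C - {u}))"
        using True that by (intro card.remove) (auto simp: nbrs_def)
      ultimately show ?thesis using True by simp
    next
      case False
      hence "nbrs E' u C = nbrs E u C" by (auto simp: nbrs_def E'_def)
      thus ?thesis using that False by simp
    qed
    have extend: "\<forall>u\<in>insert v C. even (card (nbrs E u (insert v C)))"
      if "finite C" "v \<notin> C" "\<forall>u\<in>C. even (card (nbrs E' u C))" "even (card (nbrs E v C))" for C
    proof
      fix u assume u: "u \<in> insert v C"
      have split: "card (nbrs E u (insert v C)) = card (nbrs E u {v}) + card (nbrs E u C)"
        using card_nbrs_Un_disjoint[of "{v}" C E u] that by simp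
      have "nbrs E u {v} = (if E v u then {v} else {})" using sym by (auto simp: nbrs_def)
      thus "even (card (nbrs E u (insert v C)))"
        using u that toggle[of C u] irr split by (cases "u = v") auto
    qed
    have keep: "\<forall>u\<in>C. even (card (nbrs E u C))"
      if "finite C" "\<forall>u\<in>C. even (card (nbrs E' u C))" "odd (card (nbrs E v C))" for C
      using that toggle by blast
    have "nbrs E v V = nbrs E v (P \<union> Q)" using v P irr by (auto simp: nbrs_def Q_def)
    hence odd_sum: "odd (card (nbrs E v P) + card (nbrs E v Q))"
      using odd_v card_nbrs_Un_disjoint[of P Q E v] fin by (auto simp: Q_def)
    have sets: "v \<notin> P" "v \<notin> Q" "V - insert v P = Q" "V - P = insert v Q"
      using P v by (auto simp: Q_def)
    note even_Q = even_Q[folded Q_def]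
    show ?thesis
    proof (cases "even (card (nbrs E v P))")
      case True
      hence "odd (card (nbrs E v Q))" using odd_sum by simp
      thus ?thesis
        using extend[OF fin(1) sets(1) even_P True] keep[OF fin(2) even_Q] P v sets(3)
        by (intro exI[of _ "insert v P"] conjI) auto
    next
      case False
      hence "even (card (nbrs E v Q))" using odd_sum by simp
      thus ?thesis
        using extend[OF fin(2) sets(2) even_Q] keep[OF fin(1) even_P False] P sets(4)
        by (intro exI[of _ P] conjI) auto
    qed
  qed
qed

text \<open>
  Switching the classes of an even partition on \<open>W\<close> flips the parity of every same-class
  degree, because it exchanges same-class and other-class neighbours across the cut, and
  there is an odd number of them in total.
\<close>

lemma partition_into_two_odd_sets:
  assumes "finite X" "finite W" "X \<inter> W = {}" "symp E" "irreflp E"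
    and odd_X: "\<forall>x\<in>X. odd (card (nbrs E x W))"
    and odd_W: "\<forall>w\<in>W. odd (card (nbrs E w X))"
  shows "\<exists>A\<subseteq>X \<union> W. (\<forall>v\<in>A. odd (card (nbrs E v A))) \<and>
                  (\<forall>v\<in>X \<union> W - A. odd (card (nbrs E v (X \<union> W - A))))"
proof -
  obtain P where P: "P \<subseteq> X \<union> W" and even_P: "\<forall>v\<in>P. even (card (nbrs E v P))"
      and even_Q: "\<forall>v\<in>X \<union> W - P. even (card (nbrs E v (X \<union> W - P)))"
    using partition_into_two_even_sets[OF finite_UnI[OF assms(1,2)] assms(4,5)] by blast
  have swap: "odd (card (nbrs E v (C \<inter> Y \<union> (Z - C))))"
    if "finite Y" "finite Z" "Y \<inter> Z = {}" "C \<subseteq> Y \<union> Z"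
       "even (card (nbrs E v C))" "odd (card (nbrs E v Z))" for v C Y Z
  proof -
    have "C = C \<inter> Y \<union> C \<inter> Z" "Z = C \<inter> Z \<union> (Z - C)" using that by blast+
    moreover have "card (nbrs E v (C \<inter> Y \<union> C \<inter> Z))
        = card (nbrs E v (C \<inter> Y)) + card (nbrs E v (C \<inter> Z))"
      using that by (intro card_nbrs_Un_disjoint) auto
    moreover have "card (nbrs E v (C \<inter> Z \<union> (Z - C)))
        = card (nbrs E v (C \<inter> Z)) + card (nbrs E v (Z - C))"
      using that by (intro card_nbrs_Un_disjoint) auto
    moreover have "card (nbrs E v (C \<inter> Y \<union> (Z - C)))
        = card (nbrs E v (C \<inter> Y)) + card (nbrs E v (Z - C))"
      using that by (intro card_nbrs_Un_disjoint) auto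
    ultimately show ?thesis using that(5,6) by presburger
  qed
  \<comment> \<open>Each of \<open>A\<close> and its complement has two descriptions in the form required by \<open>swap\<close>,
    one for its vertices in \<open>X\<close> and one for those in \<open>W\<close>.\<close>
  define A where "A = P \<inter> X \<union> (W - P)"
  define Q where "Q = X \<union> W - P"
  have eqs: "A = Q \<inter> W \<union> (X - Q)" "A = P \<inter> X \<union> (W - P)"
    "X \<union> W - A = P \<inter> W \<union> (X - P)" "X \<union> W - A = Q \<inter> X \<union> (W - Q)"
    using P assms(3) by (auto simp: A_def Q_def)
  have Q: "Q \<subseteq> X \<union> W" "\<forall>v\<in>Q. even (card (nbrs E v Q))" using even_Q by (auto simp: Q_def)
  have P': "P \<subseteq> W \<union> X" "Q \<subseteq> W \<union> X" "W \<inter> X = {}" using P Q assms(3) by auto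
  have "odd (card (nbrs E v A))" if "v \<in> A" for v
  proof (cases "v \<in> X")
    case True
    hence "v \<in> P" using that assms(3) by (auto simp: A_def)
    thus ?thesis using swap[of X W P v] True assms P even_P eqs(2) by simp
  next
    case False
    hence "v \<in> W" "v \<in> Q" using that by (auto simp: A_def Q_def)
    thus ?thesis using swap[of W X Q v] assms P' Q eqs(1) by simp
  qed
  moreover have "odd (card (nbrs E v (X \<union> W - A)))" if "v \<in> X \<union> W - A" for v
  proof (cases "v \<in> X")
    case True
    hence "v \<in> Q" using that assms(3) by (auto simp: A_def Q_def)
    thus ?thesis using swap[of X W Q v] True assms Q eqs(4) by simp
  next
    case False
    hence "v \<in> W" "v \<in> P" using that by (auto simp: A_def)
    thus ?thesis using swap[of W X P v] assms P' even_P eqs(3) by simp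
  qed
  moreover have "A \<subseteq> X \<union> W" by (auto simp: A_def)
  ultimately show ?thesis by blast
qed

section \<open>Dominating half of the vertices\<close>

text \<open>
  A uniformly random \<open>X\<close> gives each \<open>w\<close> the prescribed parity with probability one half. The
  induction derandomises this: deciding on \<open>d\<close> settles those \<open>w\<close> whose only neighbour is
  \<open>d\<close>, and the majority among them is served; for the others the decision only
  changes the parity still wanted from the remaining vertices. This is why the parity
  \<open>c\<close> has to be arbitrary.
\<close>

lemma half_with_prescribed_parity:
  assumes "finite D" "finite W" "\<forall>w\<in>W. nbrs E w D \<noteq> {}"
  shows "\<exists>X\<subseteq>D. card W \<le> 2 * card {w \<in> W. odd (card (nbrs E w X)) = c w}"
  using assms
proof (induction D arbitrary: W c rule: finite_induct)
  case empty
  hence "W = {}" by (auto simp: nbrs_def)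
  thus ?case by simp
next
  case (insert d D)
  define W0 where "W0 = {w \<in> W. nbrs E w D \<noteq> {}}"
  define W1 where "W1 = {w \<in> W. nbrs E w D = {}}"
  have fin: "finite W0" "finite W1" "W0 \<union> W1 = W" "W0 \<inter> W1 = {}"
    using insert.prems by (auto simp: W0_def W1_def)
  have adj: "E w d" if "w \<in> W1" for w
    using that insert.prems by (force simp: nbrs_def W1_def)
  \<comment> \<open>\<open>B\<close> consists of the vertices of \<open>W1\<close> that want \<open>d\<close> to be chosen.\<close>
  define B where "B = {w \<in> W1. c w}"
  define T where "T = (if card W1 \<le> 2 * card B then {d} else {})"
  have "\<forall>w\<in>W0. nbrs E w D \<noteq> {}" by (simp add: W0_def)
  from insert.IH[OF fin(1) this, of "\<lambda>w. c w = even (card (nbrs E w T))"]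
  obtain X where X: "X \<subseteq> D"
    and half0: "card W0 \<le> 2 * card {w \<in> W0. odd (card (nbrs E w X))
                                          = (c w = even (card (nbrs E w T)))}"
    by blast
  have T: "finite T" "T \<inter> X = {}" "T \<subseteq> {d}" using X insert.hyps by (auto simp: T_def)
  have finX: "finite X" using X insert.hyps finite_subset by blast
  have sum: "card (nbrs E w (T \<union> X)) = card (nbrs E w T) + card (nbrs E w X)" for w
    using T finX by (intro card_nbrs_Un_disjoint) auto
  have "{w \<in> W0. odd (card (nbrs E w X)) = (c w = even (card (nbrs E w T)))}
      = {w \<in> W0. odd (card (nbrs E w (T \<union> X))) = c w}" (is "_ = ?M0")
    by (auto simp: sum)
  hence half0': "card W0 \<le> 2 * card ?M0" using half0 by simp
  have "nbrs E w (T \<union> X) = T" if "w \<in> W1" for w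
    using that adj[OF that] X T by (auto simp: nbrs_def W1_def)
  hence "{w \<in> W1. odd (card (nbrs E w (T \<union> X))) = c w} = (if T = {} then W1 - B else B)"
    (is "?M1 = _") by (auto simp: B_def T_def)
  moreover have "card W1 = card B + card (W1 - B)"
    using fin card_Diff_subset[of B W1] card_mono[of W1 B] finite_subset[of B W1]
    by (auto simp: B_def)
  ultimately have half1: "card W1 \<le> 2 * card ?M1" by (auto simp: T_def)
  have "{w \<in> W. odd (card (nbrs E w (T \<union> X))) = c w} = ?M0 \<union> ?M1" using fin(3) by auto
  moreover have "card (?M0 \<union> ?M1) = card ?M0 + card ?M1"
    using fin by (intro card_Un_disjoint) auto
  moreover have "card W = card W0 + card W1" using fin by (metis card_Un_disjoint)
  ultimately have "card W \<le> 2 * card {w \<in> W. odd (card (nbrs E w (T \<union> X))) = c w}"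
    using half0' half1 by simp
  moreover have "T \<union> X \<subseteq> insert d D" using T X by auto
  ultimately show ?case by blast
qed

lemma minimal_dominating_set_with_private_neighbours:
  assumes "finite D0" "\<forall>w\<in>W. nbrs E w D0 \<noteq> {}"
  shows "\<exists>D\<subseteq>D0. (\<forall>w\<in>W. nbrs E w D \<noteq> {}) \<and> (\<forall>d\<in>D. \<exists>w\<in>W. nbrs E w D = {d})"
proof -
  let ?dom = "\<lambda>D. D \<subseteq> D0 \<and> (\<forall>w\<in>W. nbrs E w D \<noteq> {})"
  obtain D where D: "?dom D" and min: "\<And>D'. ?dom D' \<Longrightarrow> card D \<le> card D'"
    using ex_has_least_nat[of ?dom D0 card] assms by blast
  have "\<exists>w\<in>W. nbrs E w D = {d}" if "d \<in> D" for d
  proof -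
    have "card (D - {d}) < card D"
      using that D assms by (meson card_Diff1_less finite_subset)
    hence "\<not> ?dom (D - {d})" using min by (meson not_le)
    then obtain w where "w \<in> W" "nbrs E w (D - {d}) = {}" using D by blast
    moreover have "nbrs E w D \<noteq> {}" using \<open>w \<in> W\<close> D by blast
    ultimately have "nbrs E w D = {d}" by (auto simp: nbrs_def)
    thus ?thesis using \<open>w \<in> W\<close> by blast
  qed
  thus ?thesis using D by blast
qed

text \<open>
  A maximal independent set dominates its complement, and is dominated by it as there are no
  isolated vertices. The larger of the two serves as \<open>W\<close>.
\<close>

lemma half_dominated_from_outside:
  assumes "finite V" "symp E" "irreflp E" "\<forall>v\<in>V. nbrs E v V \<noteq> {}"
  shows "\<exists>W\<subseteq>V. card V \<le> 2 * card W \<and> (\<forall>w\<in>W. nbrs E w (V - W) \<noteq> {})"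
proof -
  define indep where "indep = (\<lambda>I. I \<subseteq> V \<and> (\<forall>v\<in>I. nbrs E v I = {}))"
  have "\<forall>I. indep I \<longrightarrow> card I < Suc (card V)"
    using assms(1) card_mono by (auto simp: indep_def less_Suc_eq_le)
  moreover have "indep {}" by (simp add: indep_def)
  ultimately obtain I where "indep I" and max: "\<forall>J. indep J \<longrightarrow> card J \<le> card I"
    using ex_has_greatest_nat[of indep "{}" card "Suc (card V)"] by blast
  hence I: "I \<subseteq> V" "\<forall>v\<in>I. nbrs E v I = {}" by (auto simp: indep_def)
  have finI: "finite I" using I assms(1) finite_subset by blast
  have "nbrs E v I \<noteq> {}" if v: "v \<in> V - I" for v
  proof
    assume "nbrs E v I = {}"
    hence "indep (insert v I)"
      using I v assms(2,3) by (auto simp: nbrs_def irreflp_def indep_def dest: sympD)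
    hence "card (insert v I) \<le> card I" using max by blast
    thus False using v finI by simp
  qed
  hence "\<forall>v\<in>V - I. nbrs E v (V - (V - I)) \<noteq> {}" using I by (simp add: double_diff)
  moreover have "\<forall>v\<in>I. nbrs E v (V - I) \<noteq> {}"
    using I assms(4) by (fastforce simp: nbrs_def)
  moreover have "card V = card I + card (V - I)"
    using I assms(1) finI by (simp add: card_Diff_subset card_mono)
  hence "card V \<le> 2 * card I \<or> card V \<le> 2 * card (V - I)" by linarith
  ultimately show ?thesis using I by blast
qed

section \<open>Large odd induced subgraphs\<close>

lemma large_odd_set:
  assumes "finite V" "symp E" "irreflp E" "\<forall>v\<in>V. nbrs E v V \<noteq> {}"
  shows "\<exists>S\<subseteq>V. card V \<le> 8 * card S \<and> (\<forall>v\<in>S. odd (card (nbrs E v S)))"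
proof -
  obtain W where W: "W \<subseteq> V" "card V \<le> 2 * card W" "\<forall>w\<in>W. nbrs E w (V - W) \<noteq> {}"
    using half_dominated_from_outside[OF assms] by blast
  obtain D where D: "D \<subseteq> V - W" "\<forall>w\<in>W. nbrs E w D \<noteq> {}"
      and private_nbr: "\<forall>d\<in>D. \<exists>w\<in>W. nbrs E w D = {d}"
    using minimal_dominating_set_with_private_neighbours[of "V - W" W E] assms W by blast
  have fin: "finite W" "finite D" using W D assms(1) by (auto intro: finite_subset)
  obtain p where p: "\<forall>d\<in>D. p d \<in> W \<and> nbrs E (p d) D = {d}" using private_nbr by metis
  obtain X where X: "X \<subseteq> D" and half: "card W \<le> 2 * card {w \<in> W. odd (card (nbrs E w X))}"
    using half_with_prescribed_parity[OF fin(2,1) D(2), of "\<lambda>_. True"] by auto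
  \<comment> \<open>Deleting \<open>p x\<close> from \<open>W'\<close> repairs the parity at \<open>x\<close> and is invisible to the rest of \<open>X\<close>.\<close>
  define W' where "W' = {w \<in> W. odd (card (nbrs E w X))}"
  define Bad where "Bad = {x \<in> X. even (card (nbrs E x W'))}"
  define U where "U = W' - p ` Bad"
  have finX: "finite X" "finite W'" "finite Bad" "finite U"
    using fin finite_subset[OF X] by (simp_all add: W'_def Bad_def U_def)
  have adj_p: "E x (p d) \<longleftrightarrow> x = d" if "x \<in> X" "d \<in> X" for x d
    using p that X assms(2) by (fastforce simp: nbrs_def dest: sympD)
  have p_W': "p x \<in> W'" if "x \<in> X" for x
  proof -
    have "nbrs E (p x) X = {x}" using p that X by (fastforce simp: nbrs_def)
    thus ?thesis using p that X by (auto simp: W'_def)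
  qed
  have odd_X: "odd (card (nbrs E x U))" if x: "x \<in> X" for x
  proof (cases "x \<in> Bad")
    case True
    have "nbrs E x U = nbrs E x W' - {p x}"
      using adj_p x True by (auto simp: nbrs_def U_def Bad_def)
    moreover have "p x \<in> nbrs E x W'" using p_W' adj_p x by (auto simp: nbrs_def)
    ultimately have "card (nbrs E x W') = Suc (card (nbrs E x U))"
      using card.remove[of "nbrs E x W'" "p x"] finX by (simp add: finite_nbrs)
    thus ?thesis using True by (auto simp: Bad_def)
  next
    case False
    have "nbrs E x U = nbrs E x W'"
      using adj_p x False by (auto simp: nbrs_def U_def Bad_def)
    thus ?thesis using False x by (auto simp: Bad_def)
  qed
  have disj: "X \<inter> U = {}" using X D by (auto simp: U_def W'_def)
  have "\<forall>w\<in>U. odd (card (nbrs E w X))" by (auto simp: U_def W'_def)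
  then obtain A where A: "A \<subseteq> X \<union> U" "\<forall>v\<in>A. odd (card (nbrs E v A))"
      "\<forall>v\<in>X \<union> U - A. odd (card (nbrs E v (X \<union> U - A)))"
    using partition_into_two_odd_sets[of X U E] finX disj assms(2,3) odd_X by blast
  \<comment> \<open>Each deleted vertex is paid for by a vertex of \<open>X\<close>, so \<open>X \<union> U\<close> is as large as \<open>W'\<close>.\<close>
  have "card W' - card (p ` Bad) \<le> card U" unfolding U_def
    using finX by (intro diff_card_le_card_Diff) auto
  moreover have "card (p ` Bad) \<le> card X"
    using finX card_image_le[of Bad p] card_mono[of X Bad] by (auto simp: Bad_def)
  moreover have "card (X \<union> U) = card X + card U" using finX disj by (intro card_Un_disjoint)
  moreover have "card (X \<union> U) = card A + card (X \<union> U - A)"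
    using A(1) finX card_mono[of "X \<union> U" A] by (simp add: card_Diff_subset finite_subset)
  ultimately have "card V \<le> 8 * card A \<or> card V \<le> 8 * card (X \<union> U - A)"
    using W(2) half unfolding W'_def[symmetric] by linarith
  moreover have "X \<union> U \<subseteq> V" using X D W by (auto simp: U_def W'_def)
  ultimately show ?thesis using A by (metis Diff_subset subset_trans)
qed

lemma degree_eq_card_nbrs:
  assumes "\<forall>e\<in>edges G. e \<subseteq> vertices G \<and> card e = 2"
  shows "degree G v = card (nbrs (\<lambda>u w. {u, w} \<in> edges G) v (vertices G))"
proof -
  have "{e \<in> edges G. v \<in> e} = (\<lambda>u. {v, u}) ` nbrs (\<lambda>u w. {u, w} \<in> edges G) v (vertices G)"
    using assms by (fastforce simp: nbrs_def card_2_iff insert_commute)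
  moreover have "inj (\<lambda>u. {v, u})" by (auto simp: inj_def doubleton_eq_iff)
  ultimately show ?thesis
    by (simp add: degree_def card_image inj_on_subset)
qed

theorem corollary1p3:
  fixes G :: "'a graph" and n :: nat
  assumes "finite_simple_graph G"
    and "card (vertices G) = n"
    and "\<not> (\<exists>v. isolated_vertex G v)"
  shows "real (f_o G) \<ge> real n / 8"
proof -
  define E where "E = (\<lambda>u w. {u, w} \<in> edges G)"
  have fin: "finite (vertices G)" and simple: "\<forall>e\<in>edges G. e \<subseteq> vertices G \<and> card e = 2"
    using assms(1) by (auto simp: finite_simple_graph_def)
  have "symp E" by (rule sympI) (simp add: E_def insert_commute)
  moreover have "irreflp E" using simple by (force simp: irreflp_def E_def)
  moreover have "nbrs E v (vertices G) \<noteq> {}" if "v \<in> vertices G" for v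
    using assms(3) that degree_eq_card_nbrs[OF simple, of v]
    by (auto simp: isolated_vertex_def E_def)
  ultimately obtain S where S: "S \<subseteq> vertices G" "card (vertices G) \<le> 8 * card S"
      "\<forall>v\<in>S. odd (card (nbrs E v S))"
    using large_odd_set[OF fin, of E] by blast
  have "degree (induced_subgraph G S) v = card (nbrs E v S)" if "v \<in> S" for v
  proof -
    have "\<forall>e\<in>edges (induced_subgraph G S). e \<subseteq> vertices (induced_subgraph G S) \<and> card e = 2"
      using simple by (auto simp: induced_subgraph_def edges_def vertices_def)
    moreover have "nbrs (\<lambda>u w. {u, w} \<in> edges (induced_subgraph G S)) v
        (vertices (induced_subgraph G S)) = nbrs E v S"
      using that by (auto simp: nbrs_def E_def induced_subgraph_def edges_def vertices_def)
    ultimately show ?thesis by (simp add: degree_eq_card_nbrs)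
  qed
  hence "odd_graph (induced_subgraph G S)"
    using S(3) by (simp add: odd_graph_def induced_subgraph_def vertices_def)
  hence "card S \<in> {card S | S. S \<subseteq> vertices G \<and> odd_graph (induced_subgraph G S)}"
    using S(1) by blast
  moreover have "finite {card S | S. S \<subseteq> vertices G \<and> odd_graph (induced_subgraph G S)}"
    by (rule finite_subset[of _ "card ` Pow (vertices G)"]) (auto simp: fin)
  ultimately have "card S \<le> f_o G" unfolding f_o_def by (rule Max_ge[rotated])
  thus ?thesis using S(2) assms(2) by linarith
qed

end
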